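(* Let $m$ be a positive integer, let $p>0$ and let $0<r<2$. Then there is a constant $C_{m,p}>0$ (depending only on $m$ and $p$) such that $$\left(\sum_{i_1,\dots,i_m=1}^{n}|a_{i_1,\dots,i_m}|^{r}\right)^{\frac1r}\le C_{m,p}\,n^{m\left(\frac1r-\frac12\right)}\left(\int_{[0,1]^m}\left|\sum_{i_1,\dots,i_m=1}^{n}a_{i_1,\dots,i_m}r_{i_1}(t_1)\cdots r_{i_m}(t_m)\right|^{p}dt_1\cdots dt_m\right)^{\frac1p}$$ for all positive integers $n$ and all arrays $(a_{i_1,\dots,i_m})_{i_1,\dots,i_m=1}^{n}$ of real scalars. Moreover, the exponent $m\left(\frac1r-\frac12\right)$ is optimal: if $t\in\mathbb{R}$ and there is a constant $C>0$ (not depending on $n$ or on the array) such that the inequality with $C_{m,p}\,n^{m(\frac1r-\frac12)}$ replaced by $C\,n^{t}$ holds for all positive integers $n$ and all real arrays $(a_{i_1,\dots,i_m})_{i_1,\dots,i_m=1}^{n}$, then $t\ge m\left(\frac1r-\frac12\right)$.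
   Context: For each positive integer $k$, $r_k:[0,1]\to\mathbb{R}$ denotes the Rademacher function $r_k(t)=\operatorname{sign}(\sin 2^{k}\pi t)$. The number $r$ (an exponent) is not to be confused with the functions $r_k$. *)

theory Defs
  imports "HOL-Analysis.Analysis"
begin

definition rademacher :: "nat \<Rightarrow> real \<Rightarrow> real" where
  "rademacher k t = sgn (sin (2 ^ k * pi * t))"

text \<open>A multi-index \<open>(i\<^sub>1, \<dots>, i\<^sub>m)\<close> is an extensional function on \<open>{1..m}\<close>. An array
  is a real function on multi-indices; its values outside \<open>multi_indices m n\<close> play no role.\<close>

definition multi_indices :: "nat \<Rightarrow> nat \<Rightarrow> (nat \<Rightarrow> nat) set" where
  "multi_indices m n = (\<Pi>\<^sub>E j\<in>{1..m}. {1..n})"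

definition array_norm :: "nat \<Rightarrow> nat \<Rightarrow> real \<Rightarrow> ((nat \<Rightarrow> nat) \<Rightarrow> real) \<Rightarrow> real" where
  "array_norm m n r a = (\<Sum>i\<in>multi_indices m n. \<bar>a i\<bar> powr r) powr (1 / r)"

definition rademacher_sum ::
    "nat \<Rightarrow> nat \<Rightarrow> ((nat \<Rightarrow> nat) \<Rightarrow> real) \<Rightarrow> (nat \<Rightarrow> real) \<Rightarrow> real" where
  "rademacher_sum m n a t =
     (\<Sum>i\<in>multi_indices m n. a i * (\<Prod>j\<in>{1..m}. rademacher (i j) (t j)))"

text \<open>The cube \<open>[0,1]\<^sup>m\<close> sits in the \<open>m\<close>-fold product of Lebesgue measure, so that \<open>m\<close> can be an
  ordinary natural number. The integrand is bounded and measurable, so the Bochner integral is the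
  genuine one.\<close>

definition rademacher_Lp :: "nat \<Rightarrow> nat \<Rightarrow> real \<Rightarrow> ((nat \<Rightarrow> nat) \<Rightarrow> real) \<Rightarrow> real" where
  "rademacher_Lp m n p a =
     (LINT t : (\<Pi>\<^sub>E j\<in>{1..m}. {0..1}) | (\<Pi>\<^sub>M j\<in>{1..m}. lborel).
        \<bar>rademacher_sum m n a t\<bar> powr p) powr (1 / p)"

end

theory Submission
  imports Defs "HOL-Probability.Infinite_Product_Measure" "HOL-Real_Asymp.Real_Asymp"
begin

text \<open>
  Write \<open>A\<close> for the sum of the squares \<open>a\<^sub>i\<^sup>2\<close> over the \<open>n\<^sup>m\<close> multi-indices and \<open>F\<close> for the
  multiple Rademacher sum. The upper estimate has two halves. Since \<open>r < 2\<close>, the power-mean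
  inequality bounds the \<open>r\<close>-norm of the array by \<open>n\<^sup>m\<close> to the power \<open>1/r - 1/2\<close> times \<open>sqrt A\<close>
  (\<open>array_norm_le_sqrt\<close>). What remains is the multiple Khinchine inequality, which bounds
  \<open>sqrt A\<close> by a constant times the \<open>p\<close>-norm of \<open>F\<close>, also when \<open>p\<close> is small
  (\<open>khinchine_multiple\<close>).

  Khinchine's inequality is reduced to the second and the fourth moment, with the argument of Paley
  and Zygmund: \<open>F\<^sup>2\<close> has mean \<open>A\<close>, and the mean of \<open>F\<^sup>4\<close> is at most \<open>3\<^sup>m A\<^sup>2\<close>, so \<open>F\<^sup>2\<close> is at
  least \<open>A/2\<close> on a set whose measure has a positive lower bound depending only on \<open>m\<close>. This bounds
  the \<open>p\<close>-th moment from below by a constant times \<open>A\<close> to the power \<open>p/2\<close>, for all \<open>p > 0\<close> alike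
  (\<open>moment_rademacher_chaos_lower\<close>). The fourth moment is bounded by integrating out one variable at a
  time; the coefficients of a sum in the last variable are again multiple sums, and a weighted
  Cauchy-Schwarz inequality combines their fourth moments (\<open>fourth_moment_rademacher_chaos\<close>).

  In one variable everything follows from self-similarity: on the two halves of the unit
  interval \<open>r\<^sub>1\<close> is \<open>1\<close> and \<open>-1\<close>, while \<open>r\<^sub>2, r\<^sub>3, \<dots>\<close> are rescaled copies of
  \<open>r\<^sub>1, r\<^sub>2, \<dots>\<close>. So the mean of \<open>\<phi>(c\<^sub>1 r\<^sub>1 + c\<^sub>2 r\<^sub>2 + \<dots>)\<close> is the mean of
  \<open>\<phi>(\<plusminus> c\<^sub>1 + c\<^sub>2 r\<^sub>1 + \<dots>)\<close>, averaged over the sign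
  (\<open>integral_sum_rademacher_Suc\<close>). The choices \<open>x\<^sup>2\<close>, \<open>x\<^sup>4\<close> and \<open>exp x\<close> for \<open>\<phi> x\<close> give the moments
  by induction.

  For the optimality the constant array \<open>1\<close> suffices. Its \<open>r\<close>-norm is \<open>n\<close> to the power \<open>m/r\<close>, and
  its sum \<open>F\<close> is a product of \<open>m\<close> one-variable sums, whose exponential moments show that they
  have \<open>p\<close>-norm at most a constant times \<open>sqrt n\<close>. Thus an inequality with exponent \<open>t\<close> makes
  \<open>n\<close> to the power \<open>m/r - m/2 - t\<close> bounded in \<open>n\<close>.
\<close>

section \<open>Dyadic self-similarity and the one-variable moments\<close>

text \<open>Lebesgue measure on the unit interval is kept as a measure on the whole
  line, so that its powers have the same measurable sets as the powers of \<open>lborel\<close>.\<close>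

definition unit_uniform :: "real measure" where
  "unit_uniform = density lborel (indicator {0..1})"

lemma space_unit_uniform [simp]: "space unit_uniform = UNIV"
  and sets_unit_uniform [measurable_cong]: "sets unit_uniform = sets borel"
  by (simp_all add: unit_uniform_def)

lemma prob_space_unit_uniform: "prob_space unit_uniform"
  by (rule prob_spaceI) (simp add: unit_uniform_def emeasure_density)

lemma measure_unit_uniform_UNIV [simp]: "measure unit_uniform UNIV = 1"
  using prob_space.prob_space[OF prob_space_unit_uniform] by simp

lemma integral_unit_uniform:
  fixes f :: "real \<Rightarrow> real"
  assumes [measurable]: "f \<in> borel_measurable borel"
  shows "(LINT t|unit_uniform. f t) = (LINT t|lborel. indicator {0..1} t * f t)"
proof -
  have "unit_uniform = density lborel (\<lambda>t. ennreal (indicator {0..1} t))"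
    by (simp add: unit_uniform_def ennreal_indicator)
  then have "(LINT t|unit_uniform. f t)
      = (LINT t|density lborel (\<lambda>t. ennreal (indicator {0..1} t)). f t)"
    by simp
  also have "\<dots> = (LINT t|lborel. indicator {0..1} t * f t)"
    by (subst integral_density) auto
  finally show ?thesis .
qed

text \<open>Every integrand below is a continuous function of a bounded
  Rademacher sum.\<close>

lemma (in finite_measure) integrable_continuous_bounded:
  fixes f :: "'a \<Rightarrow> real" and \<phi> :: "real \<Rightarrow> real"
  assumes f [measurable]: "f \<in> borel_measurable M"
    and bound: "\<And>x. \<bar>f x\<bar> \<le> B"
    and \<phi>: "continuous_on UNIV \<phi>"
  shows "integrable M (\<lambda>x. \<phi> (f x))"
proof -
  have "bounded (\<phi> ` {-B..B})"
    using \<phi> by (intro compact_imp_bounded compact_continuous_image)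
      (auto intro: continuous_on_subset)
  then obtain K where K: "\<And>y. y \<in> {-B..B} \<Longrightarrow> norm (\<phi> y) \<le> K"
    unfolding bounded_iff by blast
  have "norm (\<phi> (f x)) \<le> K" for x
    using K[of "f x"] bound[of x] by (simp add: abs_le_iff)
  moreover have [measurable]: "\<phi> \<in> borel_measurable borel"
    using \<phi> by (rule borel_measurable_continuous_onI)
  ultimately show ?thesis
    by (intro integrable_const_bound[where B = K]) auto
qed

lemma measurable_rademacher [measurable]: "rademacher k \<in> borel_measurable borel"
  unfolding rademacher_def by measurable

lemma abs_rademacher_le_1: "\<bar>rademacher k t\<bar> \<le> 1"
  by (simp add: rademacher_def sgn_if)

lemma rademacher_half:
  "rademacher (Suc k) (t / 2) = rademacher k t"
  by (simp add: rademacher_def mult.assoc)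

text \<open>The shift by a half is a shift of the argument of the sine by
  \<open>2\<^sup>k \<pi>\<close>. This is a whole number of periods because \<open>k \<ge> 1\<close>; for the first Rademacher function it is
  only half a period, which makes the sign change.\<close>

lemma rademacher_half_shift:
  assumes "k \<ge> 1"
  shows "rademacher (Suc k) (1 / 2 + t / 2) = rademacher k t"
proof -
  obtain l where k: "k = Suc l"
    using assms by (cases k) auto
  have "2 ^ Suc k * pi * (1 / 2 + t / 2) = 2 ^ k * pi * t + 2 * real (2 ^ l) * pi"
    by (simp add: k algebra_simps)
  then have "sin (2 ^ Suc k * pi * (1 / 2 + t / 2)) = sin (2 ^ k * pi * t)"
    by (simp only: sin_add sin_2npi cos_2npi mult_1_right mult_zero_right add_0_right)
  then show ?thesis
    by (simp add: rademacher_def)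
qed

lemma rademacher_1_half:
  assumes "0 < t" "t < 1"
  shows "rademacher 1 (t / 2) = 1" "rademacher 1 (1 / 2 + t / 2) = -1"
proof -
  have s: "sin (pi * t) > 0"
    using assms by (intro sin_gt_zero) auto
  then show "rademacher 1 (t / 2) = 1"
    by (simp add: rademacher_def)
  have "2 * pi * (1 / 2 + t / 2) = pi * t + pi"
    by (simp add: algebra_simps)
  then have "sin (2 * pi * (1 / 2 + t / 2)) = - sin (pi * t)"
    by (simp only: sin_periodic_pi)
  with s show "rademacher 1 (1 / 2 + t / 2) = -1"
    by (simp add: rademacher_def)
qed

lemma integral_unit_uniform_halves:
  fixes g :: "real \<Rightarrow> real"
  assumes g [measurable]: "g \<in> borel_measurable borel" and bound: "\<And>t. \<bar>g t\<bar> \<le> K"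
  shows "(LINT t|unit_uniform. g t) =
    ((LINT t|unit_uniform. g (t / 2)) + (LINT t|unit_uniform. g (1 / 2 + t / 2))) / 2"
proof -
  have int: "integrable lborel (\<lambda>t. indicator {a..b} t * g t)" for a b :: real
  proof (rule Bochner_Integration.integrable_bound)
    show "integrable lborel (\<lambda>t. indicator {a..b} t * K)"
      by (intro integrable_mult_left integrable_real_indicator) (auto simp: emeasure_lborel_Icc_eq)
    have "\<bar>g t\<bar> \<le> \<bar>K\<bar>" for t
      using bound[of t] by linarith
    then show "AE t in lborel. norm (indicator {a..b} t * g t) \<le> norm (indicator {a..b} t * K)"
      by (intro AE_I2) (auto simp: indicator_def)
  qed measurable
  have "(LINT t|unit_uniform. g t) = (LINT t|lborel. indicator {0..1} t * g t)"
    by (simp add: integral_unit_uniform)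
  also have "\<dots> = (LINT t|lborel. indicator {0..1/2} t * g t + indicator {1/2..1} t * g t)"
  proof (rule integral_cong_AE)
    show "AE t in lborel. indicator {0..1} t * g t =
        indicator {0..1/2} t * g t + indicator {1/2..1} t * g t"
      using AE_lborel_singleton[of "1/2 :: real"]
      by eventually_elim (auto simp: indicator_def)
  qed measurable
  also have "\<dots> = (LINT t|lborel. indicator {0..1/2} t * g t)
      + (LINT t|lborel. indicator {1/2..1} t * g t)"
    by (intro Bochner_Integration.integral_add int)
  also have "(LINT t|lborel. indicator {0..1/2} t * g t) =
      (LINT t|lborel. indicator {0..1} t * g (t / 2)) / 2"
    by (subst lborel_integral_real_affine[where c = "1/2" and t = 0])
       (auto intro!: Bochner_Integration.integral_cong simp: indicator_def)
  also have "(LINT t|lborel. indicator {1/2..1} t * g t) =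
      (LINT t|lborel. indicator {0..1} t * g (1 / 2 + t / 2)) / 2"
    by (subst lborel_integral_real_affine[where c = "1/2" and t = "1/2"])
       (auto intro!: Bochner_Integration.integral_cong simp: indicator_def)
  finally show ?thesis
    by (simp add: integral_unit_uniform)
qed

lemma abs_sum_rademacher_le:
  "\<bar>d + (\<Sum>k=1..n. c k * rademacher k t)\<bar> \<le> \<bar>d\<bar> + (\<Sum>k=1..n. \<bar>c k\<bar>)"
proof -
  have "\<bar>\<Sum>k=1..n. c k * rademacher k t\<bar> \<le> (\<Sum>k=1..n. \<bar>c k * rademacher k t\<bar>)"
    by (rule sum_abs)
  also have "\<dots> \<le> (\<Sum>k=1..n. \<bar>c k\<bar>)"
    by (intro sum_mono) (simp add: abs_mult mult_left_le abs_rademacher_le_1)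
  finally show ?thesis
    by linarith
qed

lemma integrable_sum_rademacher:
  assumes "continuous_on UNIV \<phi>"
  shows "integrable unit_uniform (\<lambda>t. \<phi> (d + (\<Sum>k=1..n. c k * rademacher k t)) :: real)"
proof -
  interpret prob_space unit_uniform
    by (rule prob_space_unit_uniform)
  show ?thesis
    using assms abs_sum_rademacher_le[where d = d and c = c and n = n]
    by (intro integrable_continuous_bounded) auto
qed

text \<open>The recursion that replaces independence. It peels off the first
  Rademacher function, not the last one: on each half of the interval the first one is constant (up to
  the end points), and rescaling that half restores the remaining ones with their indices lowered
  by one.\<close>

lemma integral_sum_rademacher_Suc:
  fixes \<phi> :: "real \<Rightarrow> real"
  assumes \<phi>: "continuous_on UNIV \<phi>"
  shows "(LINT t|unit_uniform. \<phi> (\<Sum>k=1..Suc n. c k * rademacher k t)) =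
    (LINT t|unit_uniform. (\<phi> (c 1 + (\<Sum>k=1..n. c (Suc k) * rademacher k t))
       + \<phi> (- c 1 + (\<Sum>k=1..n. c (Suc k) * rademacher k t))) / 2)"
proof -
  let ?S = "\<lambda>t. \<Sum>k=1..Suc n. c k * rademacher k t"
  let ?T = "\<lambda>t. \<Sum>k=1..n. c (Suc k) * rademacher k t"
  have [measurable]: "\<phi> \<in> borel_measurable borel"
    using \<phi> by (rule borel_measurable_continuous_onI)
  define B where "B = (\<Sum>k=1..Suc n. \<bar>c k\<bar>)"
  have "bounded (\<phi> ` {-B..B})"
    using \<phi> by (intro compact_imp_bounded compact_continuous_image)
      (auto intro: continuous_on_subset)
  then obtain K where K: "\<And>y. y \<in> {-B..B} \<Longrightarrow> norm (\<phi> y) \<le> K"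
    unfolding bounded_iff by blast
  have bound: "\<bar>\<phi> (?S t)\<bar> \<le> K" for t
    using K[of "?S t"] abs_sum_rademacher_le[where d = 0 and c = c and n = "Suc n" and t = t] by (simp add: B_def abs_le_iff)
  have S: "?S t = c 1 * rademacher 1 t + (\<Sum>k=1..n. c (Suc k) * rademacher (Suc k) t)" for t
    using sum.atLeast_Suc_atMost[of 1 "Suc n" "\<lambda>k. c k * rademacher k t"]
      sum.shift_bounds_cl_Suc_ivl[of "\<lambda>k. c k * rademacher k t" 1 n] by simp
  have interior: "AE t in unit_uniform. 0 < t \<and> t < 1"
    unfolding unit_uniform_def
    using AE_lborel_singleton[of "0 :: real"] AE_lborel_singleton[of "1 :: real"]
    by (subst AE_density) (auto simp: indicator_def elim!: eventually_elim2)
  have left: "(LINT t|unit_uniform. \<phi> (?S (t / 2))) = (LINT t|unit_uniform. \<phi> (c 1 + ?T t))"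
  proof (rule integral_cong_AE)
    show "AE t in unit_uniform. \<phi> (?S (t / 2)) = \<phi> (c 1 + ?T t)"
      using interior
    proof eventually_elim
      case (elim t)
      then show ?case
        unfolding S by (simp only: rademacher_half rademacher_1_half) simp
    qed
  qed measurable
  have right: "(LINT t|unit_uniform. \<phi> (?S (1 / 2 + t / 2)))
      = (LINT t|unit_uniform. \<phi> (- c 1 + ?T t))"
  proof (rule integral_cong_AE)
    show "AE t in unit_uniform. \<phi> (?S (1 / 2 + t / 2)) = \<phi> (- c 1 + ?T t)"
      using interior
    proof eventually_elim
      case (elim t)
      have "(\<Sum>k=1..n. c (Suc k) * rademacher (Suc k) (1 / 2 + t / 2)) = ?T t"
        by (intro sum.cong refl) (simp only: rademacher_half_shift atLeastAtMost_iff)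
      with elim show ?case
        unfolding S by (simp only: rademacher_1_half) simp
    qed
  qed measurable
  have "(LINT t|unit_uniform. \<phi> (?S t)) =
      ((LINT t|unit_uniform. \<phi> (?S (t / 2))) + (LINT t|unit_uniform. \<phi> (?S (1 / 2 + t / 2)))) / 2"
    by (rule integral_unit_uniform_halves[OF _ bound]) measurable
  also have "\<dots> = (LINT t|unit_uniform. (\<phi> (c 1 + ?T t) + \<phi> (- c 1 + ?T t)) / 2)"
    unfolding left right integral_divide_zero
    by (subst Bochner_Integration.integral_add) (intro integrable_sum_rademacher \<phi> refl)+
  finally show ?thesis .
qed

lemma second_moment_sum_rademacher:
  "(LINT t|unit_uniform. (\<Sum>k=1..n. c k * rademacher k t)\<^sup>2) = (\<Sum>k=1..n. (c k)\<^sup>2)"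
proof (induction n arbitrary: c)
  case 0
  then show ?case by simp
next
  case (Suc n)
  interpret prob_space unit_uniform
    by (rule prob_space_unit_uniform)
  let ?T = "\<lambda>t. \<Sum>k=1..n. c (Suc k) * rademacher k t"
  have int: "integrable unit_uniform (\<lambda>t. (?T t)\<^sup>2)"
    using integrable_sum_rademacher[of "\<lambda>x. x\<^sup>2" 0 "\<lambda>k. c (Suc k)" n]
    by (simp add: continuous_intros)
  have average: "((d + x)\<^sup>2 + (- d + x)\<^sup>2) / 2 = d\<^sup>2 + x\<^sup>2" for d x :: real
    by (simp add: power2_eq_square field_simps)
  have "(LINT t|unit_uniform. (\<Sum>k=1..Suc n. c k * rademacher k t)\<^sup>2) =
      (LINT t|unit_uniform. (c 1)\<^sup>2 + (?T t)\<^sup>2)"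
    using integral_sum_rademacher_Suc[where \<phi> = "\<lambda>x. x\<^sup>2" and c = c and n = n]
    by (simp only: average continuous_intros)
  also have "\<dots> = (c 1)\<^sup>2 + (\<Sum>k=1..n. (c (Suc k))\<^sup>2)"
    using int Suc.IH[of "\<lambda>k. c (Suc k)"] by (simp add: prob_space)
  also have "\<dots> = (\<Sum>k=1..Suc n. (c k)\<^sup>2)"
    using sum.atLeast_Suc_atMost[of 1 "Suc n" "\<lambda>k. (c k)\<^sup>2"]
      sum.shift_bounds_cl_Suc_ivl[of "\<lambda>k. (c k)\<^sup>2" 1 n] by simp
  finally show ?case .
qed

text \<open>The average of \<open>(x + d)\<^sup>4\<close> and \<open>(x - d)\<^sup>4\<close> is
  \<open>x\<^sup>4 + 6 d\<^sup>2 x\<^sup>2 + d\<^sup>4\<close>. Its mixed term is exactly the one in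
  \<open>3 (d\<^sup>2 + x\<^sup>2)\<^sup>2\<close>, so the recursion reproduces the constant \<open>3\<close>.\<close>

lemma fourth_moment_sum_rademacher:
  "(LINT t|unit_uniform. (\<Sum>k=1..n. c k * rademacher k t) ^ 4) \<le> 3 * (\<Sum>k=1..n. (c k)\<^sup>2)\<^sup>2"
proof (induction n arbitrary: c)
  case 0
  then show ?case by simp
next
  case (Suc n)
  interpret prob_space unit_uniform
    by (rule prob_space_unit_uniform)
  let ?T = "\<lambda>t. \<Sum>k=1..n. c (Suc k) * rademacher k t"
  define A where "A = (\<Sum>k=1..n. (c (Suc k))\<^sup>2)"
  have int2: "integrable unit_uniform (\<lambda>t. (?T t)\<^sup>2)"
    using integrable_sum_rademacher[of "\<lambda>x. x\<^sup>2" 0 "\<lambda>k. c (Suc k)" n]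
    by (simp add: continuous_intros)
  have int4: "integrable unit_uniform (\<lambda>t. (?T t) ^ 4)"
    using integrable_sum_rademacher[of "\<lambda>x. x ^ 4" 0 "\<lambda>k. c (Suc k)" n]
    by (simp add: continuous_intros)
  have average: "((d + x) ^ 4 + (- d + x) ^ 4) / 2 = d ^ 4 + 6 * d\<^sup>2 * x\<^sup>2 + x ^ 4" for d x :: real
    by (simp add: power4_eq_xxxx power2_eq_square field_simps)
  have "(LINT t|unit_uniform. (\<Sum>k=1..Suc n. c k * rademacher k t) ^ 4) =
      (LINT t|unit_uniform. c 1 ^ 4 + 6 * (c 1)\<^sup>2 * (?T t)\<^sup>2 + (?T t) ^ 4)"
    using integral_sum_rademacher_Suc[where \<phi> = "\<lambda>x. x ^ 4" and c = c and n = n]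
    by (simp only: average continuous_intros)
  also have "\<dots> = c 1 ^ 4 + 6 * (c 1)\<^sup>2 * A + (LINT t|unit_uniform. (?T t) ^ 4)"
    using int2 int4 second_moment_sum_rademacher[where c = "\<lambda>k. c (Suc k)" and n = n]
    by (simp add: prob_space A_def)
  also have "\<dots> \<le> c 1 ^ 4 + 6 * (c 1)\<^sup>2 * A + 3 * A\<^sup>2"
    using Suc.IH[of "\<lambda>k. c (Suc k)"] by (simp add: A_def)
  also have "\<dots> \<le> 3 * ((c 1)\<^sup>2 + A)\<^sup>2"
    using zero_le_power2[of "(c 1)\<^sup>2"]
    by (simp add: power2_sum algebra_simps flip: power_mult)
  also have "(c 1)\<^sup>2 + A = (\<Sum>k=1..Suc n. (c k)\<^sup>2)"
    using sum.atLeast_Suc_atMost[of 1 "Suc n" "\<lambda>k. (c k)\<^sup>2"]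
      sum.shift_bounds_cl_Suc_ivl[of "\<lambda>k. (c k)\<^sup>2" 1 n] by (simp add: A_def)
  finally show ?case .
qed

text \<open>The exponent \<open>x\<^sup>2\<close> instead of the sharp \<open>x\<^sup>2/2\<close> allows a short proof: near
  \<open>0\<close> the quadratic Taylor bound is enough, and beyond \<open>1\<close> already \<open>exp x \<le> exp (x\<^sup>2)\<close>.\<close>

lemma cosh_le_exp_square: "cosh x \<le> exp (x\<^sup>2)" for x :: real
proof -
  have "cosh y \<le> exp (y\<^sup>2)" if "y \<ge> 0" for y :: real
  proof (cases "y \<le> 1")
    case True
    \<comment> \<open>The linear terms of the two bounds cancel in the hyperbolic cosine.\<close>
    have "exp y \<le> 1 + y + y\<^sup>2"
      using True that by (simp add: exp_bound)
    moreover have "exp (- y) \<le> 1 - y + y\<^sup>2"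
    proof -
      have "1 \<le> (1 - y + y\<^sup>2) * (1 + y)"
        using that by (simp add: power2_eq_square algebra_simps)
      also have "\<dots> \<le> (1 - y + y\<^sup>2) * exp y"
        using True by (intro mult_left_mono exp_ge_add_one_self) auto
      finally show ?thesis
        by (simp add: exp_minus field_simps)
    qed
    ultimately have "cosh y \<le> 1 + y\<^sup>2"
      by (simp add: cosh_def)
    also have "\<dots> \<le> exp (y\<^sup>2)"
      by (rule exp_ge_add_one_self)
    finally show ?thesis .
  next
    case False
    have "cosh y \<le> exp y"
      using that by (simp add: cosh_def)
    also have "\<dots> \<le> exp (y\<^sup>2)"
      using False by (simp add: power2_eq_square)
    finally show ?thesis .
  qed
  from this[of x] this[of "- x"] show ?thesis
    by (cases "x \<ge> 0") auto
qed

lemma exp_moment_sum_rademacher: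
  "(LINT t|unit_uniform. exp (\<Sum>k=1..n. c k * rademacher k t)) \<le> exp (\<Sum>k=1..n. (c k)\<^sup>2)"
proof (induction n arbitrary: c)
  case 0
  interpret prob_space unit_uniform
    by (rule prob_space_unit_uniform)
  show ?case by (simp add: prob_space)
next
  case (Suc n)
  let ?T = "\<lambda>t. \<Sum>k=1..n. c (Suc k) * rademacher k t"
  have average: "(exp (d + x) + exp (- d + x)) / 2 = cosh d * exp x" for d x :: real
    by (simp only: cosh_def exp_add) (simp add: algebra_simps)
  have "(LINT t|unit_uniform. exp (\<Sum>k=1..Suc n. c k * rademacher k t)) =
      (LINT t|unit_uniform. cosh (c 1) * exp (?T t))"
    using integral_sum_rademacher_Suc[where \<phi> = exp and c = c and n = n]
    by (simp only: average continuous_intros)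
  also have "\<dots> = cosh (c 1) * (LINT t|unit_uniform. exp (?T t))"
    by simp
  also have "\<dots> \<le> exp ((c 1)\<^sup>2) * exp (\<Sum>k=1..n. (c (Suc k))\<^sup>2)"
    by (intro mult_mono cosh_le_exp_square Suc.IH) auto
  also have "\<dots> = exp (\<Sum>k=1..Suc n. (c k)\<^sup>2)"
    using sum.atLeast_Suc_atMost[of 1 "Suc n" "\<lambda>k. (c k)\<^sup>2"]
      sum.shift_bounds_cl_Suc_ivl[of "\<lambda>k. (c k)\<^sup>2" 1 n] by (simp add: exp_add)
  finally show ?case .
qed

section \<open>Moments of the multiple Rademacher sums\<close>

text \<open>The variables are indexed by an arbitrary set \<open>J\<close> so that the induction on the
  number of variables can be an induction on finite sets.\<close>

definition rademacher_chaos ::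
    "'j set \<Rightarrow> nat \<Rightarrow> (('j \<Rightarrow> nat) \<Rightarrow> real) \<Rightarrow> ('j \<Rightarrow> real) \<Rightarrow> real" where
  "rademacher_chaos J n a t =
     (\<Sum>i\<in>(\<Pi>\<^sub>E j\<in>J. {1..n}). a i * (\<Prod>j\<in>J. rademacher (i j) (t j)))"

lemma sum_PiE_insert:
  assumes "q \<notin> J"
  shows "(\<Sum>i\<in>(\<Pi>\<^sub>E j\<in>insert q J. X). f i) = (\<Sum>k\<in>X. \<Sum>i\<in>(\<Pi>\<^sub>E j\<in>J. X). f (i(q := k)))"
proof -
  have "(\<Sum>i\<in>(\<Pi>\<^sub>E j\<in>insert q J. X). f i) =
      (\<Sum>(k, i)\<in>X \<times> (\<Pi>\<^sub>E j\<in>J. X). f (i(q := k)))"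
    unfolding PiE_insert_eq using inj_combinator[OF assms, of "\<lambda>_. X"]
    by (subst sum.reindex) (auto simp: case_prod_unfold)
  then show ?thesis
    by (simp add: sum.cartesian_product)
qed

text \<open>With the other variables fixed, the sum is a one-variable Rademacher sum whose
  coefficients are the sums of the slices of the array.\<close>

lemma rademacher_chaos_insert:
  assumes "finite J" "q \<notin> J"
  shows "rademacher_chaos (insert q J) n a (x(q := y)) =
    (\<Sum>k=1..n. rademacher_chaos J n (\<lambda>i. a (i(q := k))) x * rademacher k y)"
proof -
  have "(\<Prod>j\<in>J. rademacher ((i(q := k)) j) ((x(q := y)) j)) = (\<Prod>j\<in>J. rademacher (i j) (x j))"
    for i k using assms by (intro prod.cong) auto
  with assms show ?thesis
    by (simp add: rademacher_chaos_def sum_PiE_insert sum_distrib_left sum_distrib_right mult_ac)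
qed

lemma measurable_rademacher_chaos [measurable]:
  "rademacher_chaos J n a \<in> borel_measurable (\<Pi>\<^sub>M j\<in>J. unit_uniform)"
  unfolding rademacher_chaos_def by measurable

lemma abs_rademacher_chaos_le:
  "\<bar>rademacher_chaos J n a t\<bar> \<le> (\<Sum>i\<in>(\<Pi>\<^sub>E j\<in>J. {1..n}). \<bar>a i\<bar>)"
proof -
  have "\<bar>\<Prod>j\<in>J. rademacher (i j) (t j)\<bar> \<le> 1" for i
    unfolding abs_prod by (intro prod_le_1) (auto simp: abs_rademacher_le_1)
  then show ?thesis
    unfolding rademacher_chaos_def
    by (intro order_trans[OF sum_abs] sum_mono) (simp add: abs_mult mult_left_le)
qed

lemma product_prob_space_unit_uniform: "product_prob_space (\<lambda>_. unit_uniform)"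
  by (intro product_prob_spaceI prob_space_unit_uniform)

lemma integrable_rademacher_chaos:
  assumes "continuous_on UNIV \<phi>"
  shows "integrable (\<Pi>\<^sub>M j\<in>J. unit_uniform) (\<lambda>t. \<phi> (rademacher_chaos J n a t) :: real)"
proof -
  interpret prob_space "\<Pi>\<^sub>M j\<in>J. unit_uniform"
    by (intro prob_space_PiM prob_space_unit_uniform)
  show ?thesis
    using assms abs_rademacher_chaos_le[of J n a] by (intro integrable_continuous_bounded) auto
qed

lemma second_moment_rademacher_chaos:
  assumes "finite J"
  shows "(LINT t|(\<Pi>\<^sub>M j\<in>J. unit_uniform). (rademacher_chaos J n a t)\<^sup>2)
    = (\<Sum>i\<in>(\<Pi>\<^sub>E j\<in>J. {1..n}). (a i)\<^sup>2)"
  using assms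
proof (induction J arbitrary: a rule: finite_induct)
  case empty
  show ?case
    by (simp add: rademacher_chaos_def prob_space.prob_space prob_space_PiM prob_space_unit_uniform)
next
  case (insert q J)
  interpret product_prob_space "\<lambda>_. unit_uniform"
    by (rule product_prob_space_unit_uniform)
  have "(LINT t|(\<Pi>\<^sub>M j\<in>insert q J. unit_uniform). (rademacher_chaos (insert q J) n a t)\<^sup>2)
      = (LINT x|(\<Pi>\<^sub>M j\<in>J. unit_uniform). LINT y|unit_uniform.
          (rademacher_chaos (insert q J) n a (x(q := y)))\<^sup>2)"
    by (intro product_integral_insert insert integrable_rademacher_chaos continuous_intros)
  also have "\<dots> = (LINT x|(\<Pi>\<^sub>M j\<in>J. unit_uniform).
      (\<Sum>k=1..n. (rademacher_chaos J n (\<lambda>i. a (i(q := k))) x)\<^sup>2))"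
    by (simp only: rademacher_chaos_insert[OF insert.hyps] second_moment_sum_rademacher)
  also have "\<dots> = (\<Sum>k=1..n. \<Sum>i\<in>(\<Pi>\<^sub>E j\<in>J. {1..n}). (a (i(q := k)))\<^sup>2)"
    by (subst Bochner_Integration.integral_sum)
       (auto intro!: integrable_rademacher_chaos continuous_intros simp: insert.IH)
  finally show ?case
    by (simp only: sum_PiE_insert[OF insert.hyps(2)])
qed

text \<open>The one-variable bound in the variable \<open>q\<close> leaves the mean of the square of
  \<open>\<Sum>k. (G k)\<^sup>2\<close>, where \<open>G k\<close> is the sum of the \<open>k\<close>-th slice. Cauchy-Schwarz with weights
  \<open>A k\<close>, the square sums of the slices, turns this into a combination of the fourth moments of the
  \<open>G k\<close>. These weights lose nothing: by induction the mean of \<open>(G k)\<^sup>4\<close> is at most a constant times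
  \<open>(A k)\<^sup>2\<close>, so the weighted sum is again a constant times \<open>\<Sum>k. A k\<close>.\<close>

lemma fourth_moment_rademacher_chaos:
  assumes "finite J"
  shows "(LINT t|(\<Pi>\<^sub>M j\<in>J. unit_uniform). (rademacher_chaos J n a t) ^ 4)
    \<le> 3 ^ card J * (\<Sum>i\<in>(\<Pi>\<^sub>E j\<in>J. {1..n}). (a i)\<^sup>2)\<^sup>2"
  using assms
proof (induction J arbitrary: a rule: finite_induct)
  case empty
  show ?case
    by (simp add: rademacher_chaos_def prob_space.prob_space prob_space_PiM prob_space_unit_uniform)
next
  case (insert q J)
  interpret product_prob_space "\<lambda>_. unit_uniform"
    by (rule product_prob_space_unit_uniform)
  define G where "G k x = rademacher_chaos J n (\<lambda>i. a (i(q := k))) x" for k x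
  define A where "A k = (\<Sum>i\<in>(\<Pi>\<^sub>E j\<in>J. {1..n}). (a (i(q := k)))\<^sup>2)" for k
  have A_nonneg: "A k \<ge> 0" for k
    by (simp add: A_def sum_nonneg)
  have fin: "finite (\<Pi>\<^sub>E j\<in>J. {1..n})"
    using insert.hyps by (intro finite_PiE) auto
  \<comment> \<open>With this, slices of weight zero survive the division by \<open>A k\<close>, where \<open>0 / 0 = 0\<close>.\<close>
  have G_zero: "G k x = 0" if "A k = 0" for k x
  proof -
    have "a (i(q := k)) = 0" if "i \<in> (\<Pi>\<^sub>E j\<in>J. {1..n})" for i
      using \<open>A k = 0\<close> that fin by (simp add: A_def sum_nonneg_eq_0_iff)
    then show ?thesis
      by (simp add: G_def rademacher_chaos_def)
  qed
  have int4: "integrable (\<Pi>\<^sub>M j\<in>J. unit_uniform) (\<lambda>x. G k x ^ 4)" for k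
    unfolding G_def by (intro integrable_rademacher_chaos continuous_intros)
  have weighted: "(\<Sum>k=1..n. (G k x)\<^sup>2)\<^sup>2 \<le> (\<Sum>k=1..n. A k) * (\<Sum>k=1..n. G k x ^ 4 / A k)" for x
  proof -
    have "(\<Sum>k=1..n. (G k x)\<^sup>2) = (\<Sum>k=1..n. sqrt (A k) * ((G k x)\<^sup>2 / sqrt (A k)))"
      using G_zero by (intro sum.cong) auto
    also have "\<dots>\<^sup>2 \<le> (\<Sum>k=1..n. (sqrt (A k))\<^sup>2) * (\<Sum>k=1..n. ((G k x)\<^sup>2 / sqrt (A k))\<^sup>2)"
      by (rule Cauchy_Schwarz_ineq_sum)
    also have "\<dots> = (\<Sum>k=1..n. A k) * (\<Sum>k=1..n. G k x ^ 4 / A k)"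
      using A_nonneg by (simp add: power_divide flip: power_mult)
    finally show ?thesis .
  qed
  have "(LINT t|(\<Pi>\<^sub>M j\<in>insert q J. unit_uniform). (rademacher_chaos (insert q J) n a t) ^ 4)
      = (LINT x|(\<Pi>\<^sub>M j\<in>J. unit_uniform). LINT y|unit_uniform.
          (rademacher_chaos (insert q J) n a (x(q := y))) ^ 4)"
    by (intro product_integral_insert insert integrable_rademacher_chaos continuous_intros)
  also have "\<dots> = (LINT x|(\<Pi>\<^sub>M j\<in>J. unit_uniform). LINT y|unit_uniform.
          (\<Sum>k=1..n. G k x * rademacher k y) ^ 4)"
    by (simp only: rademacher_chaos_insert[OF insert.hyps] G_def)
  also have "\<dots> \<le> (LINT x|(\<Pi>\<^sub>M j\<in>J. unit_uniform).
      3 * ((\<Sum>k=1..n. A k) * (\<Sum>k=1..n. G k x ^ 4 / A k)))"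
  proof (rule integral_mono')
    show "integrable (\<Pi>\<^sub>M j\<in>J. unit_uniform)
        (\<lambda>x. 3 * ((\<Sum>k=1..n. A k) * (\<Sum>k=1..n. G k x ^ 4 / A k)))"
      using int4 by simp
    show "(LINT y|unit_uniform. (\<Sum>k=1..n. G k x * rademacher k y) ^ 4)
        \<le> 3 * ((\<Sum>k=1..n. A k) * (\<Sum>k=1..n. G k x ^ 4 / A k))" for x
      using fourth_moment_sum_rademacher[where c = "\<lambda>k. G k x" and n = n] weighted[of x]
      by linarith
    show "0 \<le> 3 * ((\<Sum>k=1..n. A k) * (\<Sum>k=1..n. G k x ^ 4 / A k))" for x
      using A_nonneg by (simp add: sum_nonneg)
  qed
  also have "\<dots> = 3 * ((\<Sum>k=1..n. A k) *
      (\<Sum>k=1..n. (LINT x|(\<Pi>\<^sub>M j\<in>J. unit_uniform). G k x ^ 4) / A k))"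
    using int4 by simp
  also have "\<dots> \<le> 3 * ((\<Sum>k=1..n. A k) * (\<Sum>k=1..n. 3 ^ card J * (A k)\<^sup>2 / A k))"
    using A_nonneg insert.IH unfolding G_def A_def
    by (intro mult_left_mono sum_mono divide_right_mono) (auto simp: sum_nonneg)
  also have "\<dots> = 3 ^ card (insert q J) * (\<Sum>k=1..n. A k)\<^sup>2"
  proof -
    have "(\<Sum>k=1..n. 3 ^ card J * (A k)\<^sup>2 / A k) = 3 ^ card J * (\<Sum>k=1..n. A k)"
      unfolding sum_distrib_left by (intro sum.cong) (auto simp: power2_eq_square)
    then show ?thesis
      using insert.hyps by (simp add: power2_eq_square)
  qed
  also have "(\<Sum>k=1..n. A k) = (\<Sum>i\<in>(\<Pi>\<^sub>E j\<in>insert q J. {1..n}). (a i)\<^sup>2)"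
    by (simp only: A_def sum_PiE_insert[OF insert.hyps(2)])
  finally show ?case .
qed

section \<open>The multiple Khinchine inequality for every exponent\<close>

lemma square_powr_half: "x\<^sup>2 powr (q / 2) = \<bar>x\<bar> powr q" for x q :: real
proof -
  have "x\<^sup>2 = \<bar>x\<bar> powr 2"
    by (simp add: powr_numeral)
  then show ?thesis
    by (simp only: powr_powr) simp
qed

text \<open>A pointwise form of the Paley-Zygmund inequality. If \<open>u\<close> has mean \<open>1\<close> and
  \<open>u\<^sup>2\<close> has mean at most \<open>B\<close>, the left-hand side has mean at least \<open>1/4\<close>. It is positive only where
  \<open>u > 1/2\<close>, so where \<open>(2 u) powr q \<ge> 1\<close>, and it never exceeds \<open>B\<close>. Integrating it therefore bounds
  the moment of order \<open>q\<close> from below.\<close>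

lemma paley_zygmund_pointwise:
  fixes u q B :: real
  assumes "u \<ge> 0" "q > 0" "B > 0"
  shows "u - 1 / 2 - u\<^sup>2 / (4 * B) \<le> B * 2 powr q * u powr q"
proof (cases "u \<le> 1 / 2")
  case True
  have "u\<^sup>2 / (4 * B) \<ge> 0"
    using assms by simp
  with True have "u - 1 / 2 - u\<^sup>2 / (4 * B) \<le> 0"
    by linarith
  also have "0 \<le> B * 2 powr q * u powr q"
    using assms by simp
  finally show ?thesis .
next
  case False
  have "B - (u - u\<^sup>2 / (4 * B)) = (u - 2 * B)\<^sup>2 / (4 * B)"
    using assms by (simp add: power2_eq_square field_simps)
  also have "\<dots> \<ge> 0"
    using assms by simp
  finally have "u - 1 / 2 - u\<^sup>2 / (4 * B) \<le> B * 1"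
    by simp
  also have "1 \<le> (2 * u) powr q"
    using False assms by (intro ge_one_powr_ge_zero) auto
  then have "B * 1 \<le> B * (2 * u) powr q"
    using assms by (intro mult_left_mono) auto
  also have "\<dots> = B * 2 powr q * u powr q"
    using assms by (simp add: powr_mult)
  finally show ?thesis .
qed

text \<open>The pointwise inequality is integrated for \<open>u = F\<^sup>2 / A\<close>, \<open>q = p / 2\<close> and
  \<open>B\<close> equal to the constant of the fourth moment bound.\<close>

lemma moment_rademacher_chaos_lower:
  fixes p :: real and n :: nat and a :: "('j \<Rightarrow> nat) \<Rightarrow> real"
  assumes J: "finite J" and p: "p > 0"
  defines "A \<equiv> \<Sum>i\<in>(\<Pi>\<^sub>E j\<in>J. {1..n}). (a i)\<^sup>2"
  shows "A powr (p / 2) \<le> 4 * 3 ^ card J * 2 powr (p / 2) *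
    (LINT t|(\<Pi>\<^sub>M j\<in>J. unit_uniform). \<bar>rademacher_chaos J n a t\<bar> powr p)"
proof (cases "A = 0")
  case True
  then show ?thesis
    by simp
next
  case False
  define s where "s = A"
  define B :: real where "B = 3 ^ card J"
  let ?P = "\<Pi>\<^sub>M j\<in>J. unit_uniform" and ?F = "rademacher_chaos J n a"
  have s: "s > 0"
    using False by (simp add: s_def A_def order_less_le sum_nonneg)
  have B: "B > 0"
    by (simp add: B_def)
  interpret prob_space ?P
    by (intro prob_space_PiM prob_space_unit_uniform)
  have int2: "integrable ?P (\<lambda>t. (?F t)\<^sup>2)" and int4: "integrable ?P (\<lambda>t. ?F t ^ 4)"
    by (intro integrable_rademacher_chaos continuous_intros)+
  have intp: "integrable ?P (\<lambda>t. \<bar>?F t\<bar> powr p)"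
    using p by (intro integrable_rademacher_chaos continuous_on_powr' continuous_intros) auto
  have pointwise: "(?F t)\<^sup>2 / s - 1 / 2 - ?F t ^ 4 / (4 * B * s\<^sup>2)
      \<le> B * 2 powr (p / 2) / s powr (p / 2) * \<bar>?F t\<bar> powr p" for t
  proof -
    have "((?F t)\<^sup>2 / s) powr (p / 2) = \<bar>?F t\<bar> powr p / s powr (p / 2)"
      using s by (simp add: powr_divide square_powr_half)
    moreover have "((?F t)\<^sup>2 / s)\<^sup>2 / (4 * B) = ?F t ^ 4 / (4 * B * s\<^sup>2)"
      by (simp add: power_divide flip: power_mult)
    ultimately show ?thesis
      using paley_zygmund_pointwise[of "(?F t)\<^sup>2 / s" "p / 2" B] s p B by simp
  qed
  have "1 / 4 \<le> s / s - 1 / 2 - (B * s\<^sup>2) / (4 * B * s\<^sup>2)"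
    using s B by simp
  also have "\<dots> \<le> (LINT t|?P. (?F t)\<^sup>2) / s - 1 / 2 - (LINT t|?P. ?F t ^ 4) / (4 * B * s\<^sup>2)"
    using fourth_moment_rademacher_chaos[OF J, of n a]
      second_moment_rademacher_chaos[OF J, of n a] s B
    by (intro diff_mono divide_right_mono) (auto simp: s_def A_def B_def)
  also have "\<dots> = (LINT t|?P. (?F t)\<^sup>2 / s - 1 / 2 - ?F t ^ 4 / (4 * B * s\<^sup>2))"
    using int2 int4 by (simp add: prob_space)
  also have "\<dots> \<le> (LINT t|?P. B * 2 powr (p / 2) / s powr (p / 2) * \<bar>?F t\<bar> powr p)"
    using int2 int4 intp pointwise by (intro integral_mono) auto
  also have "\<dots> = B * 2 powr (p / 2) / s powr (p / 2) * (LINT t|?P. \<bar>?F t\<bar> powr p)"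
    by simp
  finally show ?thesis
    using s by (simp add: field_simps s_def B_def)
qed

text \<open>Restricting the product of Lebesgue measures to the cube gives the product of the
  uniform distributions, since both agree on boxes.\<close>

lemma integral_lborel_cube:
  fixes f :: "('j \<Rightarrow> real) \<Rightarrow> real"
  assumes J: "finite J" and f: "f \<in> borel_measurable (\<Pi>\<^sub>M j\<in>J. lborel)"
  shows "(LINT t : (\<Pi>\<^sub>E j\<in>J. {0..1}) | (\<Pi>\<^sub>M j\<in>J. lborel). f t)
    = (LINT t|(\<Pi>\<^sub>M j\<in>J. unit_uniform). f t)"
proof -
  let ?L = "\<Pi>\<^sub>M j\<in>J. (lborel :: real measure)" and ?C = "\<Pi>\<^sub>E j\<in>J. {0..1::real}"
  interpret L: product_sigma_finite "\<lambda>_. lborel :: real measure"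
    by standard
  interpret U: product_prob_space "\<lambda>_. unit_uniform"
    by (rule product_prob_space_unit_uniform)
  have C [measurable]: "?C \<in> sets ?L"
    using J by (intro sets_PiM_I_finite) auto
  have "density ?L (\<lambda>t. ennreal (indicator ?C t)) = (\<Pi>\<^sub>M j\<in>J. unit_uniform)"
  proof (rule U.PiM_eqI[OF J])
    show "sets (density ?L (\<lambda>t. ennreal (indicator ?C t))) = sets (\<Pi>\<^sub>M j\<in>J. unit_uniform)"
      by (simp cong: sets_PiM_cong add: sets_unit_uniform)
    fix A :: "'j \<Rightarrow> real set"
    assume A: "\<And>j. j \<in> J \<Longrightarrow> A j \<in> sets unit_uniform"
    then have A': "Pi\<^sub>E J A \<in> sets ?L"
      using J by (intro sets_PiM_I_finite) (auto simp: sets_unit_uniform)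
    have "emeasure (density ?L (\<lambda>t. ennreal (indicator ?C t))) (Pi\<^sub>E J A)
        = (\<integral>\<^sup>+t. indicator (?C \<inter> Pi\<^sub>E J A) t \<partial>?L)"
      using A' by (simp add: emeasure_density ennreal_indicator indicator_inter_arith)
    also have "\<dots> = emeasure ?L (?C \<inter> Pi\<^sub>E J A)"
      using A' by (intro nn_integral_indicator) auto
    also have "\<dots> = emeasure ?L (\<Pi>\<^sub>E j\<in>J. {0..1} \<inter> A j)"
      by (simp only: PiE_Int)
    also have "\<dots> = (\<Prod>j\<in>J. emeasure lborel ({0..1} \<inter> A j))"
      using J A by (intro L.emeasure_PiM) (auto simp: sets_unit_uniform)
    also have "\<dots> = (\<Prod>j\<in>J. emeasure unit_uniform (A j))"
    proof (intro prod.cong refl)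
      fix j assume "j \<in> J"
      with A have "A j \<in> sets borel"
        by (simp add: sets_unit_uniform)
      then show "emeasure lborel ({0..1} \<inter> A j) = emeasure unit_uniform (A j)"
        by (simp add: unit_uniform_def emeasure_density flip: indicator_inter_arith)
    qed
    finally show "emeasure (density ?L (\<lambda>t. ennreal (indicator ?C t))) (Pi\<^sub>E J A)
        = (\<Prod>j\<in>J. emeasure unit_uniform (A j))" .
  qed
  then have "(LINT t|(\<Pi>\<^sub>M j\<in>J. unit_uniform). f t)
      = (LINT t|density ?L (\<lambda>t. ennreal (indicator ?C t)). f t)"
    by simp
  also have "\<dots> = (LINT t:?C|?L. f t)"
    using f by (subst integral_density) (auto simp: set_lebesgue_integral_def)
  finally show ?thesis ..
qed

lemma rademacher_Lp_eq_chaos: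
  "rademacher_Lp m n p a =
    (LINT t|(\<Pi>\<^sub>M j\<in>{1..m}. unit_uniform). \<bar>rademacher_chaos {1..m} n a t\<bar> powr p) powr (1 / p)"
proof -
  have "rademacher_sum m n a = rademacher_chaos {1..m} n a"
    by (simp add: fun_eq_iff rademacher_sum_def rademacher_chaos_def multi_indices_def)
  moreover have [measurable]: "rademacher_chaos {1..m} n a \<in> borel_measurable (\<Pi>\<^sub>M j\<in>{1..m}. lborel)"
    unfolding rademacher_chaos_def by measurable
  ultimately show ?thesis
    unfolding rademacher_Lp_def by (subst integral_lborel_cube) auto
qed

lemma khinchine_multiple:
  assumes p: "p > 0"
  shows "sqrt (\<Sum>i\<in>multi_indices m n. (a i)\<^sup>2)
    \<le> (4 * 3 ^ m * 2 powr (p / 2)) powr (1 / p) * rademacher_Lp m n p a"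
proof -
  let ?A = "\<Sum>i\<in>multi_indices m n. (a i)\<^sup>2"
  let ?I = "LINT t|(\<Pi>\<^sub>M j\<in>{1..m}. unit_uniform). \<bar>rademacher_chaos {1..m} n a t\<bar> powr p"
  have "sqrt ?A = (?A powr (p / 2)) powr (1 / p)"
    using p by (simp add: powr_powr powr_half_sqrt sum_nonneg)
  also have "\<dots> \<le> (4 * 3 ^ m * 2 powr (p / 2) * ?I) powr (1 / p)"
    using p moment_rademacher_chaos_lower[where J = "{1..m}" and p = p and n = n and a = a]
    by (intro powr_mono2) (auto simp: multi_indices_def)
  also have "\<dots> = (4 * 3 ^ m * 2 powr (p / 2)) powr (1 / p) * rademacher_Lp m n p a"
    by (simp add: rademacher_Lp_eq_chaos powr_mult integral_nonneg_AE)
  finally show ?thesis .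
qed

text \<open>The concave function \<open>u powr q\<close> lies below its tangent at \<open>1\<close>.\<close>

lemma powr_le_tangent:
  fixes u q :: real
  assumes "u \<ge> 0" "0 < q" "q < 1"
  shows "u powr q \<le> q * u + (1 - q)"
proof (cases "u = 0")
  case False
  then show ?thesis
    using Youngs_inequality_0[of q "1 - q" u 1] assms by simp
qed (use assms in simp)

text \<open>The power-mean inequality over the \<open>N = n\<^sup>m\<close> multi-indices. With \<open>s\<close> the mean of the
  squares, the tangent bound for \<open>(a\<^sub>i\<^sup>2 / s) powr (r / 2)\<close> sums to \<open>N\<close>, because the mean of the
  \<open>a\<^sub>i\<^sup>2 / s\<close> is \<open>1\<close>.\<close>

lemma array_norm_le_sqrt:
  assumes r: "0 < r" "r < 2" and n: "n \<ge> 1"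
  shows "array_norm m n r a
    \<le> real n powr (real m * (1 / r - 1 / 2)) * sqrt (\<Sum>i\<in>multi_indices m n. (a i)\<^sup>2)"
proof (cases "(\<Sum>i\<in>multi_indices m n. (a i)\<^sup>2) = 0")
  case True
  have "finite (multi_indices m n)"
    unfolding multi_indices_def by (intro finite_PiE) auto
  with True have "a i = 0" if "i \<in> multi_indices m n" for i
    using that by (simp add: sum_nonneg_eq_0_iff)
  then show ?thesis
    by (simp add: array_norm_def)
next
  case False
  let ?I = "multi_indices m n"
  define N where "N = real (card ?I)"
  define s where "s = (\<Sum>i\<in>?I. (a i)\<^sup>2) / N"
  have N: "N = real n ^ m"
    by (simp add: N_def multi_indices_def card_PiE)
  have N_pos: "N > 0"
    using n by (simp add: N)
  have A_pos: "(\<Sum>i\<in>?I. (a i)\<^sup>2) > 0"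
    using False by (simp add: order_less_le sum_nonneg)
  have s: "s > 0"
    using N_pos A_pos by (simp add: s_def)
  have term_le: "\<bar>a i\<bar> powr r \<le> s powr (r / 2) * (r / 2 * ((a i)\<^sup>2 / s) + (1 - r / 2))" for i
  proof -
    have "\<bar>a i\<bar> powr r = (a i)\<^sup>2 powr (r / 2)"
      by (simp only: square_powr_half)
    also have "\<dots> = s powr (r / 2) * ((a i)\<^sup>2 / s) powr (r / 2)"
      using s by (simp add: powr_divide)
    also have "\<dots> \<le> s powr (r / 2) * (r / 2 * ((a i)\<^sup>2 / s) + (1 - r / 2))"
      using s r by (intro mult_left_mono powr_le_tangent) auto
    finally show ?thesis .
  qed
  have "(\<Sum>i\<in>?I. \<bar>a i\<bar> powr r)
      \<le> (\<Sum>i\<in>?I. s powr (r / 2) * (r / 2 * ((a i)\<^sup>2 / s) + (1 - r / 2)))"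
    by (intro sum_mono term_le)
  also have "\<dots> = s powr (r / 2) * (r / 2 * ((\<Sum>i\<in>?I. (a i)\<^sup>2) / s) + N * (1 - r / 2))"
    by (simp add: sum.distrib N_def flip: sum_distrib_left sum_divide_distrib)
  also have "(\<Sum>i\<in>?I. (a i)\<^sup>2) / s = N"
    using A_pos N_pos by (simp add: s_def)
  also have "s powr (r / 2) * (r / 2 * N + N * (1 - r / 2)) = N * s powr (r / 2)"
    by (simp add: algebra_simps)
  finally have "array_norm m n r a \<le> (N * s powr (r / 2)) powr (1 / r)"
    unfolding array_norm_def using r by (intro powr_mono2) (auto intro: sum_nonneg)
  also have "\<dots> = N powr (1 / r) * (s powr (1 / 2))"
    using N_pos r by (simp add: powr_mult powr_powr)
  also have "s powr (1 / 2) = (\<Sum>i\<in>?I. (a i)\<^sup>2) powr (1 / 2) / N powr (1 / 2)"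
    using N_pos A_pos by (simp add: s_def powr_divide)
  also have "N powr (1 / r) * ((\<Sum>i\<in>?I. (a i)\<^sup>2) powr (1 / 2) / N powr (1 / 2))
      = N powr (1 / r - 1 / 2) * sqrt (\<Sum>i\<in>?I. (a i)\<^sup>2)"
    using A_pos by (simp add: powr_diff powr_half_sqrt)
  also have "N powr (1 / r - 1 / 2) = real n powr (real m * (1 / r - 1 / 2))"
    using n by (simp add: N powr_powr flip: powr_realpow)
  finally show ?thesis .
qed

section \<open>The constant array\<close>

lemma powr_le_exp:
  fixes x p :: real
  assumes "x \<ge> 0" "p > 0"
  shows "x powr p \<le> p powr p * exp x"
proof -
  have "x / p \<le> exp (x / p)"
    using exp_ge_add_one_self[of "x / p"] by linarith
  then have "(x / p) powr p \<le> exp (x / p) powr p"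
    using assms by (intro powr_mono2) auto
  then show ?thesis
    using assms by (simp add: powr_divide exp_powr_real field_simps)
qed

text \<open>After division by \<open>sqrt n\<close> the sum has exponential moments bounded
  independently of \<open>n\<close>, because the squares of its coefficients add up to \<open>1\<close>; and the
  exponential dominates every power.\<close>

lemma moment_sum_rademacher_upper:
  fixes p :: real
  assumes p: "p > 0" and n: "n \<ge> 1"
  shows "(LINT t|unit_uniform. \<bar>\<Sum>k=1..n. rademacher k t\<bar> powr p)
    \<le> p powr p * (2 * exp 1) * real n powr (p / 2)"
proof -
  define d where "d = sqrt (real n)"
  have d: "d > 0"
    using n by (simp add: d_def)
  let ?T = "\<lambda>e t. \<Sum>k=1..n. e / d * rademacher k t"
  have T: "?T e t = e * ((\<Sum>k=1..n. rademacher k t) / d)" for e t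
    by (simp add: sum_divide_distrib sum_distrib_left)
  have exp_int: "integrable unit_uniform (\<lambda>t. exp (?T e t))" for e
    using integrable_sum_rademacher[of exp 0 "\<lambda>_. e / d" n] by (simp add: continuous_intros)
  have exp_le: "(LINT t|unit_uniform. exp (?T e t)) \<le> exp 1" if "e\<^sup>2 = 1" for e
    using exp_moment_sum_rademacher[where c = "\<lambda>_. e / d" and n = n] n that
    by (simp add: power_divide d_def)
  have "(LINT t|unit_uniform. \<bar>\<Sum>k=1..n. rademacher k t\<bar> powr p)
      \<le> (LINT t|unit_uniform. d powr p * p powr p * (exp (?T 1 t) + exp (?T (-1) t)))"
  proof (rule integral_mono')
    show "integrable unit_uniform
        (\<lambda>t. d powr p * p powr p * (exp (?T 1 t) + exp (?T (-1) t)))"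
      using exp_int by (intro integrable_mult_right Bochner_Integration.integrable_add)
    fix t
    let ?x = "(\<Sum>k=1..n. rademacher k t) / d"
    have "\<bar>\<Sum>k=1..n. rademacher k t\<bar> powr p = d powr p * \<bar>?x\<bar> powr p"
      using d by (simp add: powr_divide abs_divide)
    also have "\<dots> \<le> d powr p * (p powr p * exp \<bar>?x\<bar>)"
      using p by (intro mult_left_mono powr_le_exp) auto
    also have "exp \<bar>?x\<bar> \<le> exp ?x + exp (- ?x)"
      by (simp add: abs_if)
    finally show "\<bar>\<Sum>k=1..n. rademacher k t\<bar> powr p
        \<le> d powr p * p powr p * (exp (?T 1 t) + exp (?T (-1) t))"
      unfolding T by (simp add: mult_left_mono mult.assoc)
  qed simp
  also have "\<dots> = d powr p * p powr p *
      ((LINT t|unit_uniform. exp (?T 1 t)) + (LINT t|unit_uniform. exp (?T (-1) t)))"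
    using exp_int by (simp only: integral_mult_right_zero Bochner_Integration.integral_add)
  also have "\<dots> \<le> d powr p * p powr p * (exp 1 + exp 1)"
    by (intro mult_left_mono add_mono exp_le) auto
  also have "d powr p = real n powr (p / 2)"
    using n by (simp add: d_def powr_powr flip: powr_half_sqrt)
  finally show ?thesis
    by (simp add: mult_ac)
qed

text \<open>For the constant array the sum factors over the variables, so its moment is
  the \<open>m\<close>-th power of a one-variable moment.\<close>

lemma rademacher_Lp_const_le:
  assumes p: "p > 0" and n: "n \<ge> 1"
  shows "rademacher_Lp m n p (\<lambda>_. 1)
    \<le> (p powr p * (2 * exp 1)) powr (real m / p) * real n powr (real m / 2)"
proof -
  interpret product_prob_space "\<lambda>_. unit_uniform"
    by (rule product_prob_space_unit_uniform)
  let ?K = "p powr p * (2 * exp 1)"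
  let ?S = "\<lambda>t. \<Sum>k=1..n. rademacher k t"
  have prod_form: "rademacher_chaos {1..m} n (\<lambda>_. 1) t = (\<Prod>j\<in>{1..m}. ?S (t j))" for t
    by (simp add: rademacher_chaos_def prod_sum_PiE)
  have int: "integrable unit_uniform (\<lambda>t. \<bar>?S t\<bar> powr p)"
    using p integrable_sum_rademacher[of "\<lambda>x. \<bar>x\<bar> powr p" 0 "\<lambda>_. 1" n]
    by (simp add: continuous_on_powr' continuous_intros)
  have "(LINT t|(\<Pi>\<^sub>M j\<in>{1..m}. unit_uniform). \<bar>rademacher_chaos {1..m} n (\<lambda>_. 1) t\<bar> powr p)
      = (LINT t|(\<Pi>\<^sub>M j\<in>{1..m}. unit_uniform). (\<Prod>j\<in>{1..m}. \<bar>?S (t j)\<bar> powr p))"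
    by (simp only: prod_form abs_prod) (simp add: prod_powr_distrib)
  also have "\<dots> = (LINT t|unit_uniform. \<bar>?S t\<bar> powr p) ^ m"
    using int by (subst product_integral_prod) auto
  also have "\<dots> \<le> (?K * real n powr (p / 2)) ^ m"
    using moment_sum_rademacher_upper[OF p n] by (intro power_mono) auto
  finally have "rademacher_Lp m n p (\<lambda>_. 1) \<le> ((?K * real n powr (p / 2)) ^ m) powr (1 / p)"
    unfolding rademacher_Lp_eq_chaos using p by (intro powr_mono2) auto
  also have "\<dots> = ?K powr (real m / p) * real n powr (real m / 2)"
    using p n by (simp add: powr_mult powr_powr flip: powr_realpow)
  finally show ?thesis .
qed

lemma array_norm_const:
  assumes "n \<ge> 1"
  shows "array_norm m n r (\<lambda>_. 1) = real n powr (real m / r)"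
  using assms by (simp add: array_norm_def multi_indices_def card_PiE powr_powr flip: powr_realpow)

lemma powr_bounded_imp_exponent_nonpos:
  fixes K e :: real
  assumes "\<And>n::nat. n \<ge> 1 \<Longrightarrow> real n powr e \<le> K"
  shows "e \<le> 0"
proof (rule ccontr)
  assume "\<not> e \<le> 0"
  then have "filterlim (\<lambda>n::nat. real n powr e) at_top sequentially"
    by real_asymp
  then have "eventually (\<lambda>n. real n powr e > K) sequentially"
    by (simp add: filterlim_at_top_dense)
  with eventually_ge_at_top[of 1] have "eventually (\<lambda>_::nat. False) sequentially"
    by eventually_elim (use assms in force)
  then show False
    by simp
qed

theorem theorem1:
  fixes m :: nat and p :: real
  assumes "m \<ge> 1" and "p > 0"
  shows "(\<exists>C>0. \<forall>r::real. 0 < r \<and> r < 2 \<longrightarrow>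
            (\<forall>n\<ge>1. \<forall>a :: (nat \<Rightarrow> nat) \<Rightarrow> real.
               array_norm m n r a
                 \<le> C * real n powr (real m * (1 / r - 1 / 2)) * rademacher_Lp m n p a))
       \<and> (\<forall>r t :: real. 0 < r \<and> r < 2 \<longrightarrow>
            (\<exists>C>0. \<forall>n\<ge>1. \<forall>a :: (nat \<Rightarrow> nat) \<Rightarrow> real.
               array_norm m n r a \<le> C * real n powr t * rademacher_Lp m n p a) \<longrightarrow>
            t \<ge> real m * (1 / r - 1 / 2))"
proof (intro conjI allI impI)
  let ?C = "(4 * 3 ^ m * 2 powr (p / 2)) powr (1 / p)"
  have "array_norm m n r a
      \<le> ?C * real n powr (real m * (1 / r - 1 / 2)) * rademacher_Lp m n p a"
    if "0 < r \<and> r < 2" "n \<ge> 1" for r n and a :: "(nat \<Rightarrow> nat) \<Rightarrow> real"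
  proof -
    have "array_norm m n r a
        \<le> real n powr (real m * (1 / r - 1 / 2)) * sqrt (\<Sum>i\<in>multi_indices m n. (a i)\<^sup>2)"
      using that by (intro array_norm_le_sqrt) auto
    also have "\<dots> \<le> real n powr (real m * (1 / r - 1 / 2)) * (?C * rademacher_Lp m n p a)"
      by (intro mult_left_mono khinchine_multiple \<open>p > 0\<close>) simp
    finally show ?thesis
      by (simp only: mult_ac)
  qed
  moreover have "?C > 0"
    by simp
  ultimately show "\<exists>C>0. \<forall>r::real. 0 < r \<and> r < 2 \<longrightarrow>
      (\<forall>n\<ge>1. \<forall>a :: (nat \<Rightarrow> nat) \<Rightarrow> real.
         array_norm m n r a
           \<le> C * real n powr (real m * (1 / r - 1 / 2)) * rademacher_Lp m n p a)"
    by blast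
next
  fix r t :: real
  assume "0 < r \<and> r < 2"
  assume "\<exists>C>0. \<forall>n\<ge>1. \<forall>a :: (nat \<Rightarrow> nat) \<Rightarrow> real.
      array_norm m n r a \<le> C * real n powr t * rademacher_Lp m n p a"
  then obtain C where C: "C > 0"
    "\<And>n a. n \<ge> 1 \<Longrightarrow> array_norm m n r a \<le> C * real n powr t * rademacher_Lp m n p a"
    by blast
  define K where "K = (p powr p * (2 * exp 1)) powr (real m / p)"
  have "real m / r - t - real m / 2 \<le> 0"
  proof (rule powr_bounded_imp_exponent_nonpos)
    fix n :: nat
    assume n: "n \<ge> 1"
    have "real n powr (real m / r) \<le> C * real n powr t * rademacher_Lp m n p (\<lambda>_. 1)"
      using C(2)[OF n, of "\<lambda>_. 1"] by (simp only: array_norm_const[OF n])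
    also have "\<dots> \<le> C * real n powr t * (K * real n powr (real m / 2))"
      unfolding K_def using C(1) n \<open>p > 0\<close> by (intro mult_left_mono rademacher_Lp_const_le) auto
    finally have "real n powr (real m / r) \<le> C * K * (real n powr t * real n powr (real m / 2))"
      by (simp only: mult_ac)
    moreover have "real n powr (real m / r - t - real m / 2)
        = real n powr (real m / r) / (real n powr t * real n powr (real m / 2))"
      by (simp only: powr_diff divide_divide_eq_left)
    moreover have "real n powr t * real n powr (real m / 2) > 0"
      using n by simp
    ultimately show "real n powr (real m / r - t - real m / 2) \<le> C * K"
      by (simp only: pos_divide_le_eq)
  qed
  then show "t \<ge> real m * (1 / r - 1 / 2)"
    by (simp add: algebra_simps)
qed

end
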